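(* Let $f(x)=\sum_{k=1}^\infty c_kx^k$ be a hypergeometric function with no constant term. Then $f$ is a simultaneous eigenfunction for the set of all operators $\{U_n\}_{n=1}^\infty$ with respective eigenvalues $\{\lambda_n\}_{n=1}^\infty$ (that is, for every $n\ge1$ there is $\lambda_n\in\mathbb{C}$ with $U_nf=\lambda_nf$) if and only if $$f(x)=C\sum_{k=1}^\infty k^ax^k$$ for some $a\in\mathbb{Z}$ and $C\in\mathbb{C}$.
   Context: All series are formal power series over $\mathbb{C}$. The operator $U_n$ acts by $U_n\left(\sum_{k\ge0} c_k x^k\right) = \sum_{k\ge 0} c_{nk}x^k$. The ascending factorial is $(c)_0=1$, $(c)_k = c(c+1)\cdots(c+k-1)$. A hypergeometric function with no constant term means a series of the form $$f(x)=c\,x^j\sum_{k\ge0}\frac{(a_1)_k\cdots(a_p)_k}{(b_1)_k\cdots(b_q)_k}\frac{x^k}{k!}$$ with $c\in\mathbb{C}$, $c\neq0$, integers $j\ge1$, $p,q\ge0$, and parameters $a_i,b_i$ that are non-zero complex numbers, no $b_i$ being a non-positive integer (in particular $f\ne0$). *)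

theory Defs
  imports
    Complex_Main
    "HOL-Computational_Algebra.Computational_Algebra"
    "HOL-Library.Nonpos_Ints"
begin

definition U_op :: "nat \<Rightarrow> complex fps \<Rightarrow> complex fps" where
  "U_op n f = Abs_fps (\<lambda>k. fps_nth f (n * k))"

(* The library series fps_hypergeo as bs z has k-th coefficient
   prod_i (a_i)_k * z^k / (prod_i (b_i)_k * k!), so z = 1 gives pFq(as; bs; x);
   p and q are the lengths of the two lists. The condition on bs
   excludes b_i = 0 as well. *)
definition hypergeometric_no_const :: "complex fps \<Rightarrow> bool" where
  "hypergeometric_no_const f \<longleftrightarrow>
     (\<exists>(c::complex) (j::nat) (as::complex list) (bs::complex list).
        c \<noteq> 0 \<and> j \<ge> 1 \<and> (\<forall>a\<in>set as. a \<noteq> 0) \<and> (\<forall>b\<in>set bs. b \<notin> \<int>\<^sub>\<le>\<^sub>0) \<and>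
        f = fps_const c * fps_X ^ j * fps_hypergeo as bs 1)"

end

theory Submission
  imports Defs
begin

text \<open>
  Suppose \<^term>\<open>f\<close> is a common eigenfunction. Comparing the coefficients of \<open>x\<close> gives
  \<open>c\<^sub>n = \<lambda>\<^sub>n c\<^sub>1\<close>, so \<open>c\<^sub>1 \<noteq> 0\<close> (otherwise \<open>f = 0\<close>), which forces \<open>j = 1\<close>, and
  \<open>c\<^sub>n / c\<^sub>1\<close> is completely multiplicative. Being hypergeometric means that the ratio
  \<open>c\<^bsub>k+1\<^esub> / c\<^sub>k\<close> is a fixed rational function \<open>R(k)\<close>. Multiplicativity says that the quotient
  \<open>c\<^bsub>nk+n\<^esub> / c\<^bsub>nk\<^esub>\<close> equals \<open>c\<^bsub>k+1\<^esub> / c\<^sub>k\<close>; writing the former as a telescoping product yields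
  \<open>R(x) = R(nx) R(nx + 1) \<cdots> R(nx + n - 1)\<close> as rational functions, for every \<open>n \<ge> 1\<close>.

  Let \<open>D(z)\<close> be the order of \<open>R\<close> at \<open>z\<close>, negative at poles. This functional equation turns into
  \<open>D(z) = D(nz) + D(nz + 1) + \<cdots> + D(nz + n - 1)\<close>, and \<open>D\<close> has finite support. By
  \<open>dilation_invariant_divisor\<close>, the only such \<open>D\<close> are the integer multiples \<open>a\<close> of the divisor of
  \<open>(x + 1) / x\<close>. Hence \<open>R(x) = K ((x + 1) / x)\<^sup>a\<close> and \<open>c\<^sub>k = c\<^sub>1 K\<^bsup>k-1\<^esup> k\<^sup>a\<close>. The relation
  \<open>c\<^sub>1 c\<^sub>4 = c\<^sub>2\<^sup>2\<close> then reads \<open>K\<^sup>3 = K\<^sup>2\<close>, so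
  \<open>K = 1\<close>, because \<open>c\<^sub>2 \<noteq> 0\<close> (no \<open>a\<^sub>i\<close> is zero) makes \<open>K\<close> nonzero. Conversely, \<open>k \<mapsto> k\<^sup>a\<close> is completely
  multiplicative, so \<open>\<Sum> k\<^sup>a x\<^sup>k\<close> is an eigenfunction of \<open>U\<^sub>n\<close> with eigenvalue \<open>n\<^sup>a\<close>.
\<close>

section \<open>Divisors invariant under dilation\<close>

text \<open>
  Put \<open>z / n\<close> for \<open>z\<close> in the hypothesis: \<open>D(z / n) = D(z) + D(z + 1) + \<cdots> + D(z + n - 1)\<close>.
  For \<open>z \<noteq> 0\<close> the points \<open>z / n\<close> are distinct, so the left side vanishes for all large \<open>n\<close>:
  the sum of \<open>D\<close> over the ray \<open>z, z + 1, z + 2, \<dots>\<close> is zero. Comparing the rays that start at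
  \<open>z\<close> and \<open>z + 1\<close> gives \<open>D(z) = 0\<close> unless one of them starts at \<open>0\<close>; comparing the rays that
  start at \<open>-1\<close> and \<open>1\<close> gives \<open>D(-1) + D(0) = 0\<close>.
\<close>
lemma dilation_invariant_divisor:
  fixes D :: "complex \<Rightarrow> int"
  assumes fin: "finite {z. D z \<noteq> 0}"
    and dil: "\<And>n z. n \<ge> 1 \<Longrightarrow> D z = (\<Sum>i<n. D (of_nat n * z + of_nat i))"
  shows "z \<noteq> 0 \<Longrightarrow> z \<noteq> -1 \<Longrightarrow> D z = 0"
    and "D 0 + D (-1) = 0"
proof -
  have vanish: "eventually (\<lambda>n. (\<Sum>i<n. D (z + of_nat i)) = 0) sequentially"
    if z: "z \<noteq> 0" for z
  proof -
    have "inj_on (\<lambda>n::nat. z / of_nat n) {n. n \<ge> 1 \<and> D (z / of_nat n) \<noteq> 0}"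
      using z by (auto simp: inj_on_def field_simps)
    moreover have "finite ((\<lambda>n::nat. z / of_nat n) ` {n. n \<ge> 1 \<and> D (z / of_nat n) \<noteq> 0})"
      by (rule finite_subset[OF _ fin]) auto
    ultimately have "finite {n::nat. n \<ge> 1 \<and> D (z / of_nat n) \<noteq> 0}"
      by (metis (no_types, lifting) finite_imageD)
    then have "eventually (\<lambda>n::nat. \<not> (n \<ge> 1 \<and> D (z / of_nat n) \<noteq> 0)) sequentially"
      by (simp add: cofinite_eq_sequentially [symmetric] eventually_cofinite)
    then show ?thesis
      using eventually_ge_at_top[of 1]
    proof eventually_elim
      case (elim n)
      then show ?case using dil[of n "z / of_nat n"] by simp
    qed
  qed
  have vanish_Suc: "eventually (\<lambda>n. (\<Sum>i<Suc n. D (z + of_nat i)) = 0) sequentially"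
    if "z \<noteq> 0" for z
    using vanish[OF that] eventually_sequentially_Suc[of "\<lambda>n. (\<Sum>i<n. D (z + of_nat i)) = 0"]
    by blast
  show "D z = 0" if "z \<noteq> 0" "z \<noteq> -1" for z
  proof -
    have "z + 1 \<noteq> 0" using that(2) by (simp add: add_eq_0_iff2)
    then have "eventually (\<lambda>n. (\<Sum>i<Suc n. D (z + of_nat i)) = 0 \<and>
                 (\<Sum>i<n. D (z + 1 + of_nat i)) = 0) sequentially"
      by (intro eventually_conj vanish vanish_Suc that)
    then obtain n where "(\<Sum>i<Suc n. D (z + of_nat i)) = 0" "(\<Sum>i<n. D (z + 1 + of_nat i)) = 0"
      by (auto dest: eventually_happens)
    then show ?thesis
      by (simp add: sum.lessThan_Suc_shift add_ac del: sum.lessThan_Suc)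
  qed
  show "D 0 + D (-1) = 0"
  proof -
    have "eventually (\<lambda>n. (\<Sum>i<Suc (Suc n). D (-1 + of_nat i)) = 0) sequentially"
      using vanish_Suc[of "-1"] eventually_sequentially_Suc
            [of "\<lambda>n. (\<Sum>i<Suc n. D (-1 + of_nat i)) = 0"] by simp
    then have "eventually (\<lambda>n. (\<Sum>i<Suc (Suc n). D (-1 + of_nat i)) = 0 \<and>
                 (\<Sum>i<n. D (1 + of_nat i)) = 0) sequentially"
      by (intro eventually_conj vanish) auto
    then obtain n where "(\<Sum>i<Suc (Suc n). D (-1 + of_nat i)) = 0" "(\<Sum>i<n. D (1 + of_nat i)) = 0"
      by (auto dest: eventually_happens)
    then show ?thesis
      by (simp add: sum.lessThan_Suc_shift add_ac del: sum.lessThan_Suc)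
  qed
qed

section \<open>Orders of zeros of polynomials\<close>

lemma order_pcompose_linear:
  fixes p :: "'a :: field_char_0 poly"
  assumes p: "p \<noteq> 0" and b: "b \<noteq> 0"
  shows "order x (p \<circ>\<^sub>p [:a, b:]) = order (a + b * x) p"
proof -
  obtain q where q: "p = [:-(a + b * x), 1:] ^ order (a + b * x) p * q"
      "\<not> [:-(a + b * x), 1:] dvd q"
    using order_decomp[OF p] by blast
  have lin: "[:-(a + b * x), 1:] \<circ>\<^sub>p [:a, b:] = smult b [:-x, 1:]"
    by (simp add: pcompose_pCons)
  have nz: "poly (q \<circ>\<^sub>p [:a, b:]) x \<noteq> 0"
    using q(2) by (simp add: poly_eq_0_iff_dvd poly_pcompose mult.commute)
  then have "order x (q \<circ>\<^sub>p [:a, b:]) = 0" by (rule order_0I)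
  moreover have "(r ^ k) \<circ>\<^sub>p [:a, b:] = (r \<circ>\<^sub>p [:a, b:]) ^ k" for r :: "'a poly" and k
    by (induction k) (simp_all add: pcompose_mult pcompose_1)
  then have "p \<circ>\<^sub>p [:a, b:] =
      (smult b [:-x, 1:]) ^ order (a + b * x) p * (q \<circ>\<^sub>p [:a, b:])"
    by (subst q(1)) (simp only: pcompose_mult lin)
  moreover have "q \<circ>\<^sub>p [:a, b:] \<noteq> 0" using nz by auto
  moreover have "order x (smult b [:-x, 1:] ^ k) = k" for k
    using b by (metis smult_power order_smult order_power_n_n power_not_zero)
  ultimately show ?thesis
    using b by (simp add: order_mult)
qed

lemma order_prod:
  fixes f :: "'b \<Rightarrow> 'a :: idom poly"
  assumes "finite A" "\<And>i. i \<in> A \<Longrightarrow> f i \<noteq> 0"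
  shows "order x (\<Prod>i\<in>A. f i) = (\<Sum>i\<in>A. order x (f i))"
  using assms by (induction A rule: finite_induct) (auto simp: order_mult order_0I)

lemma poly_eq_on_positive_nats:
  fixes p q :: "'a :: field_char_0 poly"
  assumes "\<And>k::nat. k \<ge> 1 \<Longrightarrow> poly p (of_nat k) = poly q (of_nat k)"
  shows "p = q"
proof (rule ccontr)
  assume "p \<noteq> q"
  then have "finite {x. poly (p - q) x = 0}" by (intro poly_roots_finite) simp
  moreover have "of_nat ` {1..} \<subseteq> {x. poly (p - q) x = 0}"
    using assms by auto
  ultimately have "finite ((of_nat :: nat \<Rightarrow> 'a) ` {1..})" by (rule rev_finite_subset)
  then show False
    by (simp add: finite_image_iff inj_on_def infinite_Ici)
qed

lemma complex_poly_eq_if_order_eq: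
  fixes p q :: "complex poly"
  assumes "p \<noteq> 0" "q \<noteq> 0" "\<And>x. order x p = order x q"
  obtains K where "p = smult K q"
proof -
  have "proots p = proots q" using assms by (intro multiset_eqI) simp
  then have "p = smult (lead_coeff p) (smult (inverse (lead_coeff q)) q)"
    using complex_poly_decompose_multiset[of p] complex_poly_decompose_multiset[of q] assms(2)
    by (metis (no_types, lifting) leading_coeff_0_iff left_inverse smult_1_left smult_smult)
  then show thesis using that by simp
qed

section \<open>Completely multiplicative hypergeometric terms\<close>

text \<open>
  The core of the argument. Here \<open>c (k + 1) / c k\<close> is the rational function \<open>P / Q\<close>, and
  complete multiplicativity makes its divisor invariant under dilation. The hypothesis
  \<^term>\<open>c 2 \<noteq> 0\<close> rules out terminating sequences: a zero of \<open>c\<close> would propagate to all later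
  indices, in particular to some power of two.
\<close>
lemma multiplicative_hypergeometric_term_is_power:
  fixes c :: "nat \<Rightarrow> complex" and P Q :: "complex poly"
  assumes c1: "c 1 = 1" and c2: "c 2 \<noteq> 0"
    and mult: "\<And>n k. n \<ge> 1 \<Longrightarrow> k \<ge> 1 \<Longrightarrow> c (n * k) = c n * c k"
    and rec: "\<And>k. k \<ge> 1 \<Longrightarrow> c (Suc k) * poly Q (of_nat k) = c k * poly P (of_nat k)"
    and Q: "\<And>k. k \<ge> 1 \<Longrightarrow> poly Q (of_nat k) \<noteq> 0"
  obtains a :: int where "\<And>k. k \<ge> 1 \<Longrightarrow> c k = of_nat k powi a"
proof -
  have c_pow2: "c (2 ^ m) = c 2 ^ m" for m
    by (induction m) (simp_all add: c1[simplified] mult)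
  have c_nz: "c k \<noteq> 0" if "k \<ge> 1" for k
  proof
    assume "c k = 0"
    have "c (k + d) = 0" for d
    proof (induction d)
      case (Suc d)
      then show ?case using rec[of "k + d"] Q[of "k + d"] that by auto
    qed (use \<open>c k = 0\<close> in simp)
    from this[of "2 ^ k - k"] have "c (2 ^ k) = 0" by simp
    then show False using c2 by (simp add: c_pow2)
  qed
  have P: "poly P (of_nat k) \<noteq> 0" if "k \<ge> 1" for k
    using rec[OF that] Q[OF that] c_nz[of "Suc k"] by auto
  have "P \<noteq> 0" "Q \<noteq> 0" using P[of 1] Q[of 1] by auto

  \<comment> \<open>Telescoping from index \<open>n k\<close> to \<open>n (k + 1)\<close> proves the functional equation of \<open>P / Q\<close> at every
      positive integer \<open>k\<close>, hence as an identity of polynomials.\<close>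
  have identity: "P * (\<Prod>i<n. Q \<circ>\<^sub>p [:of_nat i, of_nat n:]) =
                  Q * (\<Prod>i<n. P \<circ>\<^sub>p [:of_nat i, of_nat n:])" if n: "n \<ge> 1" for n
  proof (rule poly_eq_on_positive_nats)
    fix k :: nat assume k: "k \<ge> 1"
    have "c (n * k + m) * (\<Prod>i<m. poly Q (of_nat (n * k + i))) =
          c (n * k) * (\<Prod>i<m. poly P (of_nat (n * k + i)))" for m
    proof (induction m)
      case (Suc m)
      have "c (Suc (n * k + m)) * poly Q (of_nat (n * k + m)) =
            c (n * k + m) * poly P (of_nat (n * k + m))"
        using n k by (intro rec) (simp add: Suc_le_eq)
      then show ?case using Suc.IH by (simp add: algebra_simps del: of_nat_add of_nat_mult) algebra
    qed simp
    from this[of n] have "c (n * Suc k) * (\<Prod>i<n. poly Q (of_nat (n * k + i))) =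
          c (n * k) * (\<Prod>i<n. poly P (of_nat (n * k + i)))"
      by (simp add: add_ac)
    then have "c (Suc k) * (\<Prod>i<n. poly Q (of_nat (n * k + i))) =
          c k * (\<Prod>i<n. poly P (of_nat (n * k + i)))"
      using n k c_nz[OF n] by (simp only: mult) (simp add: mult.assoc)
    then have "c k * (poly P (of_nat k) * (\<Prod>i<n. poly Q (of_nat (n * k + i)))) =
          c k * (poly Q (of_nat k) * (\<Prod>i<n. poly P (of_nat (n * k + i))))"
      using rec[OF k] by algebra
    then show "poly (P * (\<Prod>i<n. Q \<circ>\<^sub>p [:of_nat i, of_nat n:])) (of_nat k) =
               poly (Q * (\<Prod>i<n. P \<circ>\<^sub>p [:of_nat i, of_nat n:])) (of_nat k)"
      using c_nz[OF k] by (simp add: poly_prod poly_pcompose algebra_simps)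
  qed

  \<comment> \<open>The divisor of the rational function \<open>P / Q\<close>\<close>
  define D where "D z = int (order z P) - int (order z Q)" for z
  have "D z = 0" if "poly P z \<noteq> 0" "poly Q z \<noteq> 0" for z
    using that by (simp add: D_def order_0I)
  then have supp: "{z. D z \<noteq> 0} \<subseteq> {z. poly P z = 0} \<union> {z. poly Q z = 0}" by blast
  have "finite {z. D z \<noteq> 0}"
    using \<open>P \<noteq> 0\<close> \<open>Q \<noteq> 0\<close> by (intro finite_subset[OF supp] finite_UnI poly_roots_finite)
  moreover have "D z = (\<Sum>i<n. D (of_nat n * z + of_nat i))" if n: "n \<ge> 1" for n z
  proof -
    have nz: "p \<circ>\<^sub>p [:of_nat i, of_nat n:] \<noteq> 0" if "p \<noteq> 0" for p :: "complex poly" and i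
      using that n by (simp add: pcompose_eq_0_iff)
    have ord: "order z (p * (\<Prod>i<n. q \<circ>\<^sub>p [:of_nat i, of_nat n:])) =
          order z p + (\<Sum>i<n. order (of_nat n * z + of_nat i) q)"
      if "p \<noteq> 0" "q \<noteq> 0" for p q :: "complex poly"
      using that n nz[OF that(2)] by (simp add: order_mult order_prod order_pcompose_linear add.commute)
    show ?thesis
      using arg_cong[OF identity[OF n], of "order z"]
      unfolding ord[OF \<open>P \<noteq> 0\<close> \<open>Q \<noteq> 0\<close>] ord[OF \<open>Q \<noteq> 0\<close> \<open>P \<noteq> 0\<close>]
      by (simp add: D_def sum_subtractf flip: of_nat_sum)
  qed
  ultimately have D: "\<And>z. z \<noteq> 0 \<Longrightarrow> z \<noteq> -1 \<Longrightarrow> D z = 0" "D 0 + D (-1) = 0"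
    using dilation_invariant_divisor[of D] by blast+

  \<comment> \<open>Since \<open>D\<close> is \<open>a\<close> at \<open>-1\<close> and \<open>-a\<close> at \<open>0\<close>, the quotient \<open>P / Q\<close> is a constant times
      \<open>((x + 1) / x) powi a\<close>. Splitting \<open>a = u - v\<close> clears denominators for either sign of \<open>a\<close>.\<close>
  define a where "a = D (-1)"
  define u v where "u = nat a" and "v = nat (-a)"
  define L where "L = [:0, 1::complex:] ^ u * [:1, 1:] ^ v"
  define R where "R = [:0, 1::complex:] ^ v * [:1, 1:] ^ u"
  have ord_lin: "order z ([:0, 1::complex:] ^ m * [:1, 1:] ^ l) =
      (if z = 0 then m else if z = -1 then l else 0)" for z m l
    using order_power_n_n[of "0::complex" m] order_power_n_n[of "-1::complex" l]
    by (auto simp: order_mult order_0I poly_power add_eq_0_iff)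
  have nz: "P * L \<noteq> 0" "Q * R \<noteq> 0"
    using \<open>P \<noteq> 0\<close> \<open>Q \<noteq> 0\<close> by (auto simp: L_def R_def)
  have "order z (P * L) = order z (Q * R)" for z
  proof -
    have "D z = int (if z = 0 then v else if z = -1 then u else 0) -
                int (if z = 0 then u else if z = -1 then v else 0)"
      using D(1)[of z] D(2) by (auto simp: a_def u_def v_def)
    then show ?thesis
      using nz unfolding D_def by (simp add: order_mult) (simp add: L_def R_def ord_lin)
  qed
  with nz obtain K where K: "P * L = smult K (Q * R)"
    by (rule complex_poly_eq_if_order_eq)

  have ratio: "c (Suc k) = c k * K * of_nat (Suc k) powi a / of_nat k powi a" if k: "k \<ge> 1" for k
  proof -
    define x where "x = (of_nat k :: complex)"
    have x: "x \<noteq> 0" "1 + x \<noteq> 0" using k of_nat_neq_0[of k, where 'a = complex]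
      unfolding x_def by auto
    have "poly P x * (x ^ u * (1 + x) ^ v) = K * (poly Q x * (x ^ v * (1 + x) ^ u))"
      using arg_cong[OF K, of "\<lambda>p. poly p x"] by (simp add: L_def R_def poly_power)
    moreover have "poly Q x * (c (Suc k) * l) = poly Q x * (c k * K * r)"
      if "poly P x * l = K * (poly Q x * r)" for l r
      using that rec[OF k] unfolding x_def by algebra
    ultimately have "c (Suc k) * (x ^ u * (1 + x) ^ v) = c k * K * (x ^ v * (1 + x) ^ u)"
      using Q[OF k] by (simp add: x_def)
    moreover have powi: "y powi a = y ^ u / y ^ v" if "y \<noteq> 0" for y :: complex
      by (simp add: power_int_def u_def v_def inverse_eq_divide power_one_over)
    ultimately show ?thesis
      using x by (simp add: powi[OF x(1)] powi[OF x(2)] field_simps flip: x_def)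
  qed
  have closed: "c (Suc k) = K ^ k * of_nat (Suc k) powi a" for k
  proof (induction k)
    case (Suc k)
    then show ?case using ratio[of "Suc k"] by (simp add: field_simps del: of_nat_Suc)
  qed (simp add: c1[simplified])
  have "K = 1"
  proof -
    have "c 4 = c 2 * c 2" using mult[of 2 2] by simp
    then have "K ^ 3 * 4 powi a = K ^ 2 * (2 powi a * 2 powi a)"
      using closed[of 1] closed[of 3] by (simp add: power2_eq_square mult_ac numeral_2_eq_2[symmetric])
    moreover have "(4::complex) powi a = 2 powi a * 2 powi a"
      by (simp flip: power_int_mult_distrib)
    moreover have "K \<noteq> 0" using c2 closed[of 1] by (auto simp: numeral_2_eq_2)
    ultimately show ?thesis by (simp add: power2_eq_square power3_eq_cube)
  qed
  show thesis
  proof (rule that[of a])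
    fix k :: nat assume "k \<ge> 1"
    then show "c k = of_nat k powi a" using closed[of "k - 1"] \<open>K = 1\<close> by simp
  qed
qed

section \<open>Simultaneous eigenfunctions\<close>

text \<open>
  The coefficients \<open>f\<^sub>k\<close> satisfy \<open>f\<^bsub>nk\<^esub> = l f\<^sub>k\<close> and in particular \<open>f\<^sub>n = l f\<^sub>1\<close>. Eliminating \<open>l\<close> leaves
  complete multiplicativity up to scaling, without a division by \<open>f\<^sub>1\<close>, which may be zero a priori.
\<close>
lemma eigenfunction_coeff:
  assumes "\<forall>n\<ge>1. \<exists>l. U_op n f = fps_const l * f"
    and "n \<ge> 1"
  shows "fps_nth f 1 * fps_nth f (n * k) = fps_nth f n * fps_nth f k"
proof -
  from assms obtain l where l: "U_op n f = fps_const l * f" by blast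
  have "fps_nth f (n * k) = l * fps_nth f k" for k
    using arg_cong[OF l, of "\<lambda>g. fps_nth g k"] by (simp add: U_op_def)
  from this[of 1] this[of k] show ?thesis by simp
qed

theorem theorem7p1:
  fixes f :: "complex fps"
  assumes "hypergeometric_no_const f"
  shows "(\<forall>n\<ge>1. \<exists>l::complex. U_op n f = fps_const l * f) \<longleftrightarrow>
         (\<exists>(a::int) (C::complex).
            f = fps_const C * Abs_fps (\<lambda>k. if k = 0 then 0 else of_nat k powi a))"
proof
  assume "\<exists>(a::int) (C::complex).
            f = fps_const C * Abs_fps (\<lambda>k. if k = 0 then 0 else of_nat k powi a)"
  then obtain a :: int and C
    where f: "f = fps_const C * Abs_fps (\<lambda>k. if k = 0 then 0 else of_nat k powi a)" by blast
  have "U_op n f = fps_const (of_nat n powi a) * f" if "n \<ge> 1" for n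
    using that by (auto simp: f U_op_def fps_eq_iff power_int_mult_distrib)
  then show "\<forall>n\<ge>1. \<exists>l. U_op n f = fps_const l * f" by blast
next
  assume eig: "\<forall>n\<ge>1. \<exists>l. U_op n f = fps_const l * f"
  obtain c j as bs where c: "c \<noteq> 0" and j: "j \<ge> 1" and as: "\<forall>a\<in>set as. a \<noteq> 0"
      and bs: "\<forall>b\<in>set bs. b \<notin> \<int>\<^sub>\<le>\<^sub>0"
      and f: "f = fps_const c * fps_X ^ j * fps_hypergeo as bs 1"
    using assms unfolding hypergeometric_no_const_def by blast
  have f_nth: "fps_nth f k = (if k < j then 0 else c * fps_nth (fps_hypergeo as bs 1) (k - j))" for k
    unfolding f mult.assoc by (simp add: fps_X_power_mult_nth del: fps_hypergeo_nth)
  have "fps_nth f j = c" by (simp add: f_nth del: fps_hypergeo_nth)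
  \<comment> \<open>If \<open>j > 1\<close>, then the coefficient of \<open>x\<close> is zero, and \<open>n = k = j\<close> gives \<open>c\<^sup>2 = 0\<close>.\<close>
  have "j = 1"
    using eigenfunction_coeff[OF eig j, of j] c j \<open>fps_nth f j = c\<close> f_nth[of 1]
    by (cases "j = 1") auto
  \<comment> \<open>The series is shifted by \<open>j = 1\<close>, so the factors \<open>a + m\<close> and \<open>b + m\<close> of the \<open>m\<close>-th term ratio
      become \<open>a - 1 + k\<close> and \<open>b - 1 + k\<close> at \<open>k = m + 1\<close>; the factor \<open>x\<close> of \<open>Q\<close> stems from the factorial.\<close>
  define P where "P = (\<Prod>a\<leftarrow>as. [:a - 1, 1:])"
  define Q where "Q = [:0, 1:] * (\<Prod>b\<leftarrow>bs. [:b - 1, 1:])"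
  have poly_lin: "poly (\<Prod>b\<leftarrow>xs. [:b - 1, 1:]) y = (\<Prod>b\<leftarrow>xs. b - 1 + y)" for xs and y :: complex
    by (induction xs) (simp_all add: algebra_simps)
  have foldl_lin: "foldl (\<lambda>r b. r * (b + of_nat n)) s xs =
      s * poly (\<Prod>b\<leftarrow>xs. [:b - 1, 1:]) (of_nat (Suc n))" for s :: complex and xs n
    by (induction xs arbitrary: s) (simp_all add: algebra_simps)
  define d where "d k = fps_nth f k / c" for k
  have d_Suc: "d (Suc k) = fps_nth (fps_hypergeo as bs 1) k" for k
    using c by (simp add: d_def f_nth \<open>j = 1\<close> del: fps_hypergeo_nth)
  have Q: "poly Q (of_nat (Suc k)) \<noteq> 0" for k
  proof -
    have "b + of_nat k \<noteq> 0" if "b \<in> set bs" for b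
      using bs that plus_of_nat_eq_0_imp by blast
    then show ?thesis
      by (auto simp: Q_def poly_lin prod_list_zero_iff simp del: of_nat_Suc) auto
  qed
  have rec: "d (Suc k) * poly Q (of_nat k) = d k * poly P (of_nat k)" if k: "k \<ge> 1" for k
  proof -
    obtain m where m: "k = Suc m" using k by (cases k) auto
    show ?thesis
      using Q[of m] unfolding m d_Suc fps_hypergeo_rec foldl_lin
      by (simp add: P_def Q_def del: of_nat_Suc fps_hypergeo_nth)
  qed
  obtain a :: int where a: "\<And>k. k \<ge> 1 \<Longrightarrow> d k = of_nat k powi a"
  proof (rule multiplicative_hypergeometric_term_is_power[of d Q P])
    show d1: "d 1 = 1" using d_Suc[of 0] by (simp del: fps_hypergeo_nth)
    \<comment> \<open>The parameters \<open>a\<close> are nonzero, and their product is the value of \<open>P\<close> at \<open>1\<close>.\<close>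
    have "poly P 1 \<noteq> 0" using as by (auto simp: P_def poly_lin prod_list_zero_iff)
    then show "d 2 \<noteq> 0" using rec[of 1] d1 by (auto simp: numeral_2_eq_2)
    show "d (n * k) = d n * d k" if "n \<ge> 1" for n k
      using eigenfunction_coeff[OF eig that, of k] \<open>fps_nth f j = c\<close> c
      by (simp add: d_def \<open>j = 1\<close> field_simps)
    show "poly Q (of_nat k) \<noteq> 0" if "k \<ge> 1" for k
      using Q[of "k - 1"] that by simp
  qed (use rec that in blast)+
  have "fps_nth f k = c * (if k = 0 then 0 else of_nat k powi a)" for k
    using a[of k] c f_nth[of 0] \<open>j = 1\<close> by (auto simp: d_def field_simps)
  then have "f = fps_const c * Abs_fps (\<lambda>k. if k = 0 then 0 else of_nat k powi a)"
    by (simp add: fps_eq_iff)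
  then show "\<exists>(a::int) C. f = fps_const C * Abs_fps (\<lambda>k. if k = 0 then 0 else of_nat k powi a)"
    by blast
qed

end
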